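(* Let $n,k,d\ge1$ and let $S_n$ act on $V_k=(\mathbb R^n)^{\otimes k}$ by permuting each of the $k$ indices simultaneously, and likewise on $W_d=(\mathbb R^n)^{\otimes d}$. For a partition of $n$ encoded by $\mathbf m=(\mathbf m_1,\dots,\mathbf m_n)\in\mathbb N_0^n$ with $\sum_t t\,\mathbf m_t=n$ (here $\mathbf m_t$ is the number of parts of size $t$), and formal variables $s_1,s_2,\dots$, set $$Z(S_n^{(k)})[s]=\sum_{\mathbf m\in P_n}\frac{1}{\prod_{t=1}^n t^{\mathbf m_t}\mathbf m_t!}\prod_{(j_1,\dots,j_k)\in[n]^k} s_{\mathrm{lcm}(j_1,\dots,j_k)}^{\prod_{t=1}^k \mathbf m_{j_t}j_t/\mathrm{lcm}(j_1,\dots,j_k)},$$ and $Z_W(S_n^{(k)}\times S_n^{(d)})[s]$ given by the same expression with each summand additionally multiplied by $\mathbf m_1^{\,d}$. Then, as formal power series in $x$, (i) $\sum_{c\ge0}\dim_{\mathbb R}\big(\mathbb R[V_k]^{S_n}_c\big)\,x^c = Z(S_n^{(k)})[s_i=1+x^i+x^{2i}+\cdots]$, where $\mathbb R[V_k]^{S_n}_c$ is the space of $S_n$-invariant homogeneous polynomials of degree $c$ on $V_k$; and (ii) $\sum_{c\ge0}\dim_{\mathbb R}\big((\mathbb R[V_k]_c\otimes W_d)^{S_n}\big)\,x^c=Z_W(S_n^{(k)}\times S_n^{(d)})[s_i=1+x^i+x^{2i}+\cdots]$, where $(\mathbb R[V_k]_c\otimes W_d)^{S_n}$ is the space of $S_n$-equivariant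 polynomial maps $V_k\to W_d$ whose components are homogeneous of degree $c$.
   Context: $P_n$ denotes the set of integer partitions of $n$, each encoded by its multiplicity vector $\mathbf m$. $\mathrm{lcm}$ is the least common multiple. Exponents $\prod_t \mathbf m_{j_t}j_t/\mathrm{lcm}$ equal to $0$ give factor $1$. A map $P:V_k\to W_d$ is equivariant if $P(g\cdot v)=g\cdot P(v)$ for all $g\in S_n$. *)

theory Defs
  imports Main "HOL-Library.Function_Algebras" "HOL-Library.Multiset"
    "HOL-Computational_Algebra.Formal_Power_Series"
    "HOL-Combinatorics.Permutations"
begin

text \<open>Indices of (R^n)^{\<otimes>k}: k-tuples over [n] = {0..<n}, represented as lists.
  A tensor v in V_k is a function nat list => real (only values on the index set matter).\<close>

definition idx :: "nat \<Rightarrow> nat \<Rightarrow> nat list set" where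
  "idx n k = {js. length js = k \<and> set js \<subseteq> {..<n}}"

definition tact :: "(nat \<Rightarrow> nat) \<Rightarrow> (nat list \<Rightarrow> real) \<Rightarrow> (nat list \<Rightarrow> real)" where
  "tact g v = (\<lambda>js. v (map (inv g) js))"

definition monoms_deg :: "nat \<Rightarrow> nat \<Rightarrow> nat \<Rightarrow> nat list multiset set" where
  "monoms_deg n k c = {M. set_mset M \<subseteq> idx n k \<and> size M = c}"

definition hom_polys :: "nat \<Rightarrow> nat \<Rightarrow> nat \<Rightarrow> ((nat list \<Rightarrow> real) \<Rightarrow> real) set" where
  "hom_polys n k c = {f. \<exists>a :: nat list multiset \<Rightarrow> real.
      f = (\<lambda>v. \<Sum>M\<in>monoms_deg n k c. a M * prod_mset (image_mset v M))}"

definition inv_polys :: "nat \<Rightarrow> nat \<Rightarrow> nat \<Rightarrow> ((nat list \<Rightarrow> real) \<Rightarrow> real) set" where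
  "inv_polys n k c = {f \<in> hom_polys n k c. \<forall>g. g permutes {..<n} \<longrightarrow> (\<forall>v. f (tact g v) = f v)}"

definition equiv_maps :: "nat \<Rightarrow> nat \<Rightarrow> nat \<Rightarrow> nat \<Rightarrow>
    ((nat list \<Rightarrow> real) \<Rightarrow> (nat list \<Rightarrow> real)) set" where
  "equiv_maps n k d c = {P.
      (\<forall>js \<in> idx n d. (\<lambda>v. P v js) \<in> hom_polys n k c) \<and>
      (\<forall>js. js \<notin> idx n d \<longrightarrow> (\<forall>v. P v js = 0)) \<and>
      (\<forall>g. g permutes {..<n} \<longrightarrow> (\<forall>v. P (tact g v) = tact g (P v)))}"

definition rdim :: "('a \<Rightarrow> real) set \<Rightarrow> nat" where
  "rdim S = vector_space.dim (\<lambda>r f. (\<lambda>x. r * f x)) S"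

definition rdim2 :: "('a \<Rightarrow> 'b \<Rightarrow> real) set \<Rightarrow> nat" where
  "rdim2 S = vector_space.dim (\<lambda>r f. (\<lambda>x y. r * f x y)) S"

definition partitions_mult :: "nat \<Rightarrow> (nat \<Rightarrow> nat) set" where
  "partitions_mult n = {m. (\<forall>t. (t < 1 \<or> t > n) \<longrightarrow> m t = 0) \<and> (\<Sum>t=1..n. t * m t) = n}"

definition tuples :: "nat \<Rightarrow> nat \<Rightarrow> nat list set" where
  "tuples n k = {js. length js = k \<and> set js \<subseteq> {1..n}}"

definition cyc_weight :: "nat \<Rightarrow> (nat \<Rightarrow> nat) \<Rightarrow> real" where
  "cyc_weight n m = 1 / (\<Prod>t=1..n. real t ^ m t * fact (m t))"

definition cyc_exp :: "(nat \<Rightarrow> nat) \<Rightarrow> nat list \<Rightarrow> nat" where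
  "cyc_exp m js = (\<Prod>j\<leftarrow>js. m j * j) div Lcm (set js)"

definition Zk :: "nat \<Rightarrow> nat \<Rightarrow> (nat \<Rightarrow> real fps) \<Rightarrow> real fps" where
  "Zk n k s = (\<Sum>m\<in>partitions_mult n. fps_const (cyc_weight n m) *
      (\<Prod>js\<in>tuples n k. s (Lcm (set js)) ^ cyc_exp m js))"

definition ZW :: "nat \<Rightarrow> nat \<Rightarrow> nat \<Rightarrow> (nat \<Rightarrow> real fps) \<Rightarrow> real fps" where
  "ZW n k d s = (\<Sum>m\<in>partitions_mult n. fps_const (cyc_weight n m * real (m 1) ^ d) *
      (\<Prod>js\<in>tuples n k. s (Lcm (set js)) ^ cyc_exp m js))"

definition geom :: "nat \<Rightarrow> real fps" where
  "geom i = Abs_fps (\<lambda>c. if i dvd c then 1 else 0)"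

end

theory Submission
  imports Defs "HOL-Library.Disjoint_Sets" "HOL-Combinatorics.Cycles"
begin

text \<open>
  Monomials are linearly independent as functions, so the coefficients of an equivariant map
  are functions on pairs (monomial, index of \<open>W_d\<close>) that are constant on the orbits of the
  symmetric group; the dimension is the number of orbits, which Burnside's lemma turns into
  an average of fixed point counts. A permutation \<open>g\<close> fixes \<open>m_1 ^ d\<close> indices of \<open>W_d\<close>, and the
  monomials it fixes are the multisets with constant multiplicity along every cycle of \<open>g\<close> on
  the \<open>k\<close>-tuples, which gives one geometric series per cycle. The cycle through a tuple has
  length the lcm of the cycle lengths of its entries. So the number of cycles of length \<open>l\<close> is
  the number of tuples with lcm \<open>l\<close>, divided by \<open>l\<close>, and no product of cycles has to be
  decomposed explicitly. Finally the permutations of a given cycle type are counted. Invariant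
  polynomials are the case \<open>d = 0\<close>.
\<close>

section \<open>Orbit-constant combinations and independence of monomials\<close>

text \<open>The sums \<open>B A\<close> of the vectors over the single parts form a basis: a
  combination whose coefficients are constant on parts collapses to a combination of these sums, and
  a relation among them is a relation among the \<open>b x\<close>. Independence is assumed only for
  the indexed family, in the form in which polynomial coefficients deliver it.\<close>

lemma (in vector_space) dim_constant_on_parts:
  fixes b :: "'x \<Rightarrow> 'b"
  assumes fin: "finite X" and part: "partition_on X Q"
    and indep: "\<And>a. (\<Sum>x\<in>X. a x *s b x) = 0 \<Longrightarrow> \<forall>x\<in>X. a x = 0"
  shows "dim {\<Sum>x\<in>X. a x *s b x | a. \<forall>A\<in>Q. \<forall>x\<in>A. \<forall>y\<in>A. a x = a y} = card Q"
    (is "dim ?V = _")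
proof -
  define B where "B A = (\<Sum>x\<in>A. b x)" for A
  \<comment> \<open>\<open>c u\<close> spreads one coefficient per part over the points of that
    part; disjointness of the parts makes the selected part unique.\<close>
  define c where "c u x = u (THE A. A \<in> Q \<and> x \<in> A)" for u :: "'x set \<Rightarrow> 'a" and x
  have finQ: "finite Q"
    using fin part by (simp add: finite_elements)
  have sum_parts: "(\<Sum>x\<in>X. h x) = (\<Sum>A\<in>Q. \<Sum>x\<in>A. h x)" for h :: "'x \<Rightarrow> 'b"
    using sum.partition[OF fin part] .
  have c: "c u x = u A" if "A \<in> Q" "x \<in> A" for u A x
  proof -
    have "(THE A. A \<in> Q \<and> x \<in> A) = A"
      using that partition_onD2[OF part]
      by (intro the_equality) (auto simp: disjoint_def)
    then show ?thesis by (simp add: c_def)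
  qed
  have comb: "(\<Sum>A\<in>Q. u A *s B A) = (\<Sum>x\<in>X. c u x *s b x)" for u
    unfolding sum_parts B_def scale_sum_right by (intro sum.cong refl) (simp add: c)
  have zero: "u A = 0" if sum0: "(\<Sum>A\<in>Q. u A *s B A) = 0" and A: "A \<in> Q" for u A
  proof -
    obtain x where x: "x \<in> A" using partition_onD3[OF part] A by fastforce
    then have "x \<in> X" using partition_onD1[OF part] A by auto
    then show ?thesis using indep[of "c u"] sum0 comb[of u] c[OF A x, of u] by simp
  qed
  have inj: "inj_on B Q"
  proof (rule inj_onI, rule ccontr)
    fix A A' assume A: "A \<in> Q" "A' \<in> Q" "B A = B A'" "A \<noteq> A'"
    define u :: "'x set \<Rightarrow> 'a" where "u C = (if C = A then 1 else if C = A' then -1 else 0)" for C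
    have "(\<Sum>C\<in>Q. u C *s B C) = (\<Sum>C\<in>{A, A'}. u C *s B C)"
      using A finQ by (intro sum.mono_neutral_right) (auto simp: u_def)
    also have "\<dots> = 0" using A by (simp add: u_def)
    finally show False using zero[of u A] A by (simp add: u_def)
  qed
  show ?thesis
  proof (rule dim_unique)
    show "B ` Q \<subseteq> ?V"
    proof
      fix y assume "y \<in> B ` Q"
      then obtain A where A: "A \<in> Q" "y = B A" by auto
      define u :: "'x set \<Rightarrow> 'a" where "u C = (if C = A then 1 else 0)" for C
      have "y = (\<Sum>C\<in>Q. u C *s B C)"
      proof -
        have "(\<Sum>C\<in>Q. u C *s B C) = (\<Sum>C\<in>Q. if C = A then B C else 0)"
          by (intro sum.cong) (auto simp: u_def)
        then show ?thesis using A finQ by simp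
      qed
      then show "y \<in> ?V" unfolding comb using c[of _ _ u] by (auto intro!: exI[of _ "c u"])
    qed
    show "?V \<subseteq> span (B ` Q)"
    proof clarify
      fix a :: "'x \<Rightarrow> 'a" assume a: "\<forall>A\<in>Q. \<forall>x\<in>A. \<forall>y\<in>A. a x = a y"
      \<comment> \<open>The coefficient of a part is read off at an arbitrary
        representative.\<close>
      define u where "u A = a (SOME x. x \<in> A)" for A
      have "(\<Sum>x\<in>X. a x *s b x) = (\<Sum>A\<in>Q. u A *s B A)"
        unfolding sum_parts B_def scale_sum_right
        by (intro sum.cong refl) (metis a someI u_def)
      then show "(\<Sum>x\<in>X. a x *s b x) \<in> span (B ` Q)"
        by (simp add: span_sum span_scale span_base)
    qed
    show "independent (B ` Q)"
    proof (rule independent_if_scalars_zero)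
      show "finite (B ` Q)" using finQ by simp
      fix f y assume "(\<Sum>y\<in>B ` Q. f y *s y) = 0" "y \<in> B ` Q"
      then show "f y = 0" using zero[of "f \<circ> B"] by (auto simp: sum.reindex[OF inj])
    qed
    show "card (B ` Q) = card Q" by (simp add: card_image inj)
  qed
qed

text \<open>Monomials are multiplicative in the point of evaluation, so Dedekind's argument for
  the linear independence of characters applies.\<close>

lemma monomials_independent:
  fixes a :: "'i multiset \<Rightarrow> real"
  assumes "finite X" and "\<And>v. (\<Sum>M\<in>X. a M * prod_mset (image_mset v M)) = 0"
  shows "\<forall>M\<in>X. a M = 0"
  using assms
proof (induction X arbitrary: a rule: finite_induct)
  case empty
  then show ?case by simp
next
  case (insert N X)
  define mon where "mon M v = prod_mset (image_mset v M)" for M :: "'i multiset" and v :: "'i \<Rightarrow> real"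
  have mult: "mon M (\<lambda>i. u i * v i) = mon M u * mon M v" for M u v
    by (simp add: mon_def prod_mset.distrib)
  have zero: "a N * mon N v + (\<Sum>M\<in>X. a M * mon M v) = 0" for v
    using insert.prems[of v] insert.hyps by (simp add: mon_def)
  \<comment> \<open>Evaluate the relation at the pointwise product of \<open>u\<close> and
    \<open>v\<close>, and subtract \<open>mon N u\<close> times the relation at \<open>v\<close>.
    The term of \<open>N\<close> cancels, so the induction hypothesis applies to what
    remains.\<close>
  have "a M * (mon M u - mon N u) = 0" if "M \<in> X" for M u
  proof -
    have "(\<Sum>M\<in>X. a M * (mon M u - mon N u) * mon M v) = 0" for v
      using zero[of "\<lambda>i. u i * v i"] zero[of v, THEN arg_cong, of "\<lambda>r. mon N u * r"]
      by (simp add: mult algebra_simps sum_subtractf sum_distrib_left)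
    then show ?thesis
      using insert.IH[of "\<lambda>M. a M * (mon M u - mon N u)"] that by (simp add: mon_def)
  qed
  moreover have "\<exists>u. mon M u \<noteq> mon N u" if "M \<in> X" for M
  proof -
    have "M \<noteq> N" using that insert.hyps by auto
    then obtain i where i: "count M i \<noteq> count N i" by (auto simp: multiset_eq_iff)
    \<comment> \<open>This point separates \<open>M\<close> from \<open>N\<close>: the monomials
      become powers of 2 with different exponents.\<close>
    have "mon K (\<lambda>j. if j = i then 2 else 1) = 2 ^ count K i" for K
      by (induction K) (auto simp: mon_def)
    then show ?thesis using i by (intro exI[of _ "\<lambda>j. if j = i then 2 else 1"]) simp
  qed
  ultimately have X: "a M = 0" if "M \<in> X" for M
    using that by fastforce
  then have "a N = 0"
    using zero[of "\<lambda>_. 1"] by (simp add: mon_def)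
  with X show ?case by simp
qed

section \<open>Orbit counting\<close>

text \<open>The pairs of a permutation and a point fixed by it are counted in two ways; summed over
  the points of one orbit, the stabilisers account for each permutation of \<open>S\<close> exactly
  once. The action laws are required only on \<open>Y\<close>.\<close>

lemma burnside_permutes:
  fixes \<phi> :: "('s \<Rightarrow> 's) \<Rightarrow> 'y \<Rightarrow> 'y"
  assumes fS: "finite S" and fY: "finite Y"
    and closed: "\<And>g y. g permutes S \<Longrightarrow> y \<in> Y \<Longrightarrow> \<phi> g y \<in> Y"
    and id: "\<And>y. y \<in> Y \<Longrightarrow> \<phi> id y = y"
    and comp: "\<And>g h y. g permutes S \<Longrightarrow> h permutes S \<Longrightarrow> y \<in> Y \<Longrightarrow> \<phi> (g \<circ> h) y = \<phi> g (\<phi> h y)"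
  defines "r \<equiv> {(y, z). y \<in> Y \<and> (\<exists>g. g permutes S \<and> z = \<phi> g y)}"
  shows "equiv Y r"
    and "card (Y // r) * fact (card S) = (\<Sum>g | g permutes S. card {y \<in> Y. \<phi> g y = y})"
proof -
  let ?G = "{g. g permutes S}"
  have inv: "\<phi> (inv g) (\<phi> g y) = y" if "g permutes S" "y \<in> Y" for g y
    using comp[of "inv g" g y] that id by (simp add: permutes_inv permutes_inv_o)
  show eq: "equiv Y r"
  proof (rule equivI)
    show "r \<subseteq> Y \<times> Y" using closed by (auto simp: r_def)
    show "refl_on Y r" using id permutes_id closed by (auto simp: r_def refl_on_def intro!: exI[of _ id])
    show "sym r" using inv closed permutes_inv by (fastforce simp: r_def sym_def)
    show "trans r"
    proof (rule transI)
      fix x y z assume "(x, y) \<in> r" "(y, z) \<in> r"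
      then obtain g h where "x \<in> Y" "g permutes S" "h permutes S" "y = \<phi> g x" "z = \<phi> h y"
        by (auto simp: r_def)
      then show "(x, z) \<in> r"
        by (auto simp: r_def comp[symmetric] intro!: exI[of _ "h \<circ> g"] permutes_compose)
    qed
  qed
  have finG: "finite ?G" by (rule finite_permutations[OF fS])
  \<comment> \<open>Composing with \<open>h\<close> on the right carries the stabiliser of
    \<open>z\<close> onto the coset of permutations that move \<open>y\<close> to
    \<open>z\<close>.\<close>
  have stab: "card {g \<in> ?G. \<phi> g z = z} = card {g \<in> ?G. \<phi> g y = z}"
    if "y \<in> Y" "h permutes S" "\<phi> h y = z" for y z h
  proof (rule bij_betw_same_card[of "\<lambda>g. g \<circ> h"], rule bij_betw_byWitness[where f' = "\<lambda>g. g \<circ> inv h"])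
    have z: "z \<in> Y" using that closed by auto
    have hz: "\<phi> (inv h) z = y" using inv that by blast
    show "(\<lambda>g. g \<circ> h) ` {g \<in> ?G. \<phi> g z = z} \<subseteq> {g \<in> ?G. \<phi> g y = z}"
      using that z by (auto intro: permutes_compose simp: comp)
    show "(\<lambda>g. g \<circ> inv h) ` {g \<in> ?G. \<phi> g y = z} \<subseteq> {g \<in> ?G. \<phi> g z = z}"
      using that z hz by (auto intro: permutes_compose simp: comp permutes_inv)
  qed (use that in \<open>auto simp: comp_assoc permutes_inv_o\<close>)
  \<comment> \<open>With a base point \<open>y\<close> of the orbit fixed, the cosets belonging to
    the points \<open>z\<close> of the orbit partition the whole group.\<close>
  have orb: "(\<Sum>z\<in>A. card {g \<in> ?G. \<phi> g z = z}) = fact (card S)" if A: "A \<in> Y // r" for A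
  proof -
    obtain y where y: "y \<in> Y" "A = r `` {y}" using A by (rule quotientE)
    have A_eq: "A = (\<lambda>g. \<phi> g y) ` ?G" using y by (auto simp: r_def)
    have "(\<Sum>z\<in>A. card {g \<in> ?G. \<phi> g z = z}) = (\<Sum>z\<in>A. card {g \<in> ?G. \<phi> g y = z})"
      using stab[OF y(1)] by (intro sum.cong) (auto simp: A_eq)
    also have "\<dots> = (\<Sum>z\<in>A. \<Sum>g\<in>{g \<in> ?G. \<phi> g y = z}. 1)" by simp
    also have "\<dots> = (\<Sum>g\<in>?G. 1)"
      using finG by (intro sum.group) (auto simp: A_eq)
    also have "\<dots> = fact (card S)" using card_permutations[OF refl fS] by simp
    finally show ?thesis .
  qed
  have "(\<Sum>g\<in>?G. card {y \<in> Y. \<phi> g y = y}) = (\<Sum>g\<in>?G. \<Sum>y\<in>Y. if \<phi> g y = y then 1 else 0)"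
    using fY by (intro sum.cong refl) (simp add: sum.If_cases Int_def)
  also have "\<dots> = (\<Sum>y\<in>Y. \<Sum>g\<in>?G. if \<phi> g y = y then 1 else 0)" by (rule sum.swap)
  also have "\<dots> = (\<Sum>y\<in>Y. card {g \<in> ?G. \<phi> g y = y})"
    using finG by (intro sum.cong refl) (simp add: sum.If_cases Int_def)
  also have "\<dots> = (\<Sum>A\<in>Y // r. \<Sum>y\<in>A. card {g \<in> ?G. \<phi> g y = y})"
    by (rule sum.partition[OF fY partition_on_quotient[OF eq]])
  also have "\<dots> = card (Y // r) * fact (card S)" using orb by simp
  finally show "card (Y // r) * fact (card S) = (\<Sum>g\<in>?G. card {y \<in> Y. \<phi> g y = y})" by simp
qed

section \<open>Multisets fixed by a permutation\<close>

lemma finite_multisets_size: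
  assumes "finite X"
  shows "finite {M. set_mset M \<subseteq> X \<and> size M = c}"
proof (rule finite_surj)
  show "finite {xs. set xs \<subseteq> X \<and> length xs = c}" using assms by (rule finite_lists_length_eq)
  show "{M. set_mset M \<subseteq> X \<and> size M = c} \<subseteq> mset ` {xs. set xs \<subseteq> X \<and> length xs = c}"
  proof
    fix M assume M: "M \<in> {M. set_mset M \<subseteq> X \<and> size M = c}"
    obtain xs where "mset xs = M" using ex_mset by blast
    with M show "M \<in> mset ` {xs. set xs \<subseteq> X \<and> length xs = c}" by auto
  qed
qed

lemma geom_nth [simp]: "fps_nth (geom i) c = (if i dvd c then 1 else 0)"
  by (simp add: geom_def)

text \<open>Such a multiset amounts to one multiplicity per part. Multiplicity \<open>e\<close> on a
  part \<open>A\<close> contributes \<open>e * card A\<close> to the size, which gives one geometric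
  series per part; adding a part is a Cauchy product.\<close>

lemma fps_multisets_constant_on_parts:
  assumes "finite Q" "disjoint Q" "\<And>A. A \<in> Q \<Longrightarrow> finite A" "{} \<notin> Q"
  shows "Abs_fps (\<lambda>c. real (card {M. set_mset M \<subseteq> \<Union>Q \<and> size M = c \<and>
      (\<forall>A\<in>Q. \<forall>x\<in>A. \<forall>y\<in>A. count M x = count M y)})) = (\<Prod>A\<in>Q. geom (card A))"
  using assms
proof (induction Q rule: finite_induct)
  case empty
  have "{M :: 'a multiset. M = {#} \<and> size M = c} = (if c = 0 then {{#}} else {})" for c
    by auto
  then show ?case by (simp add: fps_eq_iff cong: conj_cong)
next
  case (insert A Q)
  define const where "const R M \<longleftrightarrow> (\<forall>A\<in>R. \<forall>x\<in>A. \<forall>y\<in>A. count M x = count M y)"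
    for R and M :: "'a multiset"
  define F where "F R c = {M. set_mset M \<subseteq> \<Union>R \<and> size M = c \<and> const R M}" for R c
  have constD: "count M x = count M y" if "const R M" "B \<in> R" "x \<in> B" "y \<in> B" for R M B x y
    using that unfolding const_def by blast
  have finA: "finite A" and "A \<noteq> {}" using insert.prems by auto
  then obtain a where a: "a \<in> A" by auto
  have cA: "card A > 0" using finA a by (auto simp: card_gt_0_iff)
  have disj: "x \<notin> A" if "B \<in> Q" "x \<in> B" for B x
    using insert.prems(1) insert.hyps(2) that by (auto simp: pairwise_insert disjnt_def)
  have finF: "finite (F R c)" if "finite R" "\<And>A. A \<in> R \<Longrightarrow> finite A" for R c
    unfolding F_def using that
    by (intro finite_subset[OF _ finite_multisets_size[of "\<Union>R" c]]) auto
  \<comment> \<open>Here \<open>i\<close> is the share of the size that lies in the new part, hence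
    a multiple of \<open>card A\<close>.\<close>
  have card_F: "card (F (insert A Q) c) = (\<Sum>i | i \<le> c \<and> card A dvd i. card (F Q (c - i)))" for c
  proof -
    let ?I = "{i. i \<le> c \<and> card A dvd i}"
    \<comment> \<open>\<open>put\<close> adds the same number of copies of every element of
      \<open>A\<close>. Its inverse \<open>split\<close> reads this number off at the chosen point
      \<open>a\<close> and deletes the elements of \<open>A\<close>.\<close>
    define put where "put = (\<lambda>(i, M). M + repeat_mset (i div card A) (mset_set A))"
    define split where "split M = (card A * count M a, filter_mset (\<lambda>x. x \<notin> A) M)" for M
    have supp: "count M x = 0" if "M \<in> F Q j" "x \<in> A" for j M x
    proof -
      have "set_mset M \<subseteq> \<Union>Q" using that by (simp add: F_def)
      then have "x \<notin># M" using disj that(2) by blast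
      then show ?thesis by (simp add: count_eq_zero_iff)
    qed
    have cnt: "count (put (i, M)) x = (if x \<in> A then i div card A else count M x)"
      if "M \<in> F Q j" for i j M x
      using finA supp[OF that] by (auto simp: put_def)
    have filter_A: "filter_mset (\<lambda>x. x \<in> A) M = repeat_mset (count M a) (mset_set A)"
      if "M \<in> F (insert A Q) c" for M
    proof (rule multiset_eqI)
      fix x
      show "count (filter_mset (\<lambda>x. x \<in> A) M) x = count (repeat_mset (count M a) (mset_set A)) x"
        using that finA constD[of "insert A Q" M A x a] a by (cases "x \<in> A") (auto simp: F_def)
    qed
    have size_split: "size (filter_mset (\<lambda>x. x \<notin> A) M) + card A * count M a = c"
      if "M \<in> F (insert A Q) c" for M
    proof -
      have "c = size M" using that by (simp add: F_def)
      also have "M = filter_mset (\<lambda>x. x \<notin> A) M + filter_mset (\<lambda>x. x \<in> A) M"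
        using multiset_partition[of M "\<lambda>x. x \<notin> A"] by simp
      also have "size \<dots> = size (filter_mset (\<lambda>x. x \<notin> A) M) + card A * count M a"
        using finA by (simp add: filter_A[OF that])
      finally show ?thesis by simp
    qed
    have "bij_betw put (Sigma ?I (\<lambda>i. F Q (c - i))) (F (insert A Q) c)"
    proof (rule bij_betw_byWitness[where f' = split])
      show "\<forall>p\<in>Sigma ?I (\<lambda>i. F Q (c - i)). split (put p) = p"
      proof clarify
        fix i M assume i: "card A dvd i" and M: "M \<in> F Q (c - i)"
        show "split (put (i, M)) = (i, M)"
          using i a cnt[OF M, of i] supp[OF M] by (simp add: split_def multiset_eq_iff)
      qed
      show "\<forall>M\<in>F (insert A Q) c. put (split M) = M"
      proof
        fix M assume M: "M \<in> F (insert A Q) c"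
        have "put (split M) = filter_mset (\<lambda>x. x \<notin> A) M + filter_mset (\<lambda>x. x \<in> A) M"
          using cA by (simp add: filter_A[OF M] put_def split_def)
        also have "\<dots> = M" using multiset_partition[of M "\<lambda>x. x \<notin> A"] by simp
        finally show "put (split M) = M" .
      qed
      show "put ` Sigma ?I (\<lambda>i. F Q (c - i)) \<subseteq> F (insert A Q) c"
      proof clarify
        fix i M assume i: "i \<le> c" "card A dvd i" and M: "M \<in> F Q (c - i)"
        have "size (put (i, M)) = c"
          using i M by (auto simp: put_def F_def)
        moreover have "set_mset (put (i, M)) \<subseteq> \<Union>(insert A Q)"
        proof -
          have "x \<in> A \<or> x \<in># M" if "x \<in># put (i, M)" for x
          proof (cases "x \<in> A")
            case False
            then have "count (put (i, M)) x = count M x" by (simp add: cnt[OF M])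
            then show ?thesis using that by (metis count_eq_zero_iff)
          qed simp
          moreover have "set_mset M \<subseteq> \<Union>Q" using M by (simp add: F_def)
          ultimately show ?thesis by blast
        qed
        moreover have "const (insert A Q) (put (i, M))"
        proof -
          have "const Q M" using M by (simp add: F_def)
          show ?thesis
            unfolding const_def
          proof (intro ballI)
            fix B x y assume "B \<in> insert A Q" "x \<in> B" "y \<in> B"
            then show "count (put (i, M)) x = count (put (i, M)) y"
              using disj constD[OF \<open>const Q M\<close>, of B x y] by (cases "B = A") (simp_all add: cnt[OF M])
          qed
        qed
        ultimately show "put (i, M) \<in> F (insert A Q) c"
          by (simp add: F_def)
      qed
      show "split ` F (insert A Q) c \<subseteq> Sigma ?I (\<lambda>i. F Q (c - i))"
      proof
        fix p assume "p \<in> split ` F (insert A Q) c"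
        then obtain M where M: "M \<in> F (insert A Q) c" and p: "p = split M" by auto
        have "const Q (filter_mset (\<lambda>x. x \<notin> A) M)"
        proof -
          have "const (insert A Q) M" using M by (simp add: F_def)
          then have "const Q M" unfolding const_def by blast
          show ?thesis
            unfolding const_def
          proof (intro ballI)
            fix B x y assume "B \<in> Q" "x \<in> B" "y \<in> B"
            then show "count (filter_mset (\<lambda>x. x \<notin> A) M) x = count (filter_mset (\<lambda>x. x \<notin> A) M) y"
              using disj constD[OF \<open>const Q M\<close>, of B x y] by simp
          qed
        qed
        moreover have "size (filter_mset (\<lambda>x. x \<notin> A) M) = c - card A * count M a"
          using size_split[OF M] by linarith
        ultimately have "filter_mset (\<lambda>x. x \<notin> A) M \<in> F Q (c - card A * count M a)"
          using M by (auto simp: F_def)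
        moreover have "card A * count M a \<le> c" using size_split[OF M] by linarith
        ultimately show "p \<in> Sigma ?I (\<lambda>i. F Q (c - i))"
          by (simp add: p split_def)
      qed
    qed
    then have "card (F (insert A Q) c) = card (Sigma ?I (\<lambda>i. F Q (c - i)))"
      by (simp add: bij_betw_same_card)
    also have "\<dots> = (\<Sum>i\<in>?I. card (F Q (c - i)))"
      using insert.hyps insert.prems by (intro card_SigmaI) (auto intro!: finF)
    finally show ?thesis .
  qed
  have IH: "Abs_fps (\<lambda>c. real (card (F Q c))) = (\<Prod>A\<in>Q. geom (card A))"
    unfolding F_def const_def using insert.prems by (intro insert.IH) (auto simp: pairwise_insert)
  have "Abs_fps (\<lambda>c. real (card (F (insert A Q) c))) = geom (card A) * (\<Prod>A\<in>Q. geom (card A))"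
  proof (rule fps_ext)
    fix c
    have "fps_nth (geom (card A) * (\<Prod>A\<in>Q. geom (card A))) c
        = (\<Sum>i=0..c. if card A dvd i then real (card (F Q (c - i))) else 0)"
      unfolding IH[symmetric] fps_mult_nth by (intro sum.cong) auto
    also have "\<dots> = (\<Sum>i | i \<le> c \<and> card A dvd i. real (card (F Q (c - i))))"
      by (rule sum.mono_neutral_cong_right) auto
    finally show "fps_nth (Abs_fps (\<lambda>c. real (card (F (insert A Q) c)))) c
        = fps_nth (geom (card A) * (\<Prod>A\<in>Q. geom (card A))) c"
      by (simp add: card_F)
  qed
  then show ?case unfolding F_def const_def prod.insert[OF insert.hyps] .
qed

section \<open>The cycles of a permutation as a partition\<close>

definition cycle_sets :: "('a \<Rightarrow> 'a) \<Rightarrow> 'a set \<Rightarrow> 'a set set" where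
  "cycle_sets p X = (\<lambda>x. set (support p x)) ` X"

lemma mem_support_self:
  assumes "permutation p" shows "x \<in> set (support p x)"
  using least_power_of_permutation(2)[OF assms, of x] by force

lemma partition_on_cycle_sets:
  assumes "finite X" "p permutes X"
  shows "partition_on X (cycle_sets p X)"
proof (rule partition_onI)
  have p: "permutation p" using assms permutation_permutes by blast
  show "\<Union>(cycle_sets p X) = X"
  proof
    show "\<Union>(cycle_sets p X) \<subseteq> X"
      using permutes_in_funpow_image[OF assms(2)] by (auto simp: cycle_sets_def)
    show "X \<subseteq> \<Union>(cycle_sets p X)"
      unfolding cycle_sets_def using mem_support_self[OF p] by blast
  qed
  show "disjnt A B" if "A \<in> cycle_sets p X" "B \<in> cycle_sets p X" "A \<noteq> B" for A B
    using disjoint_support[OF p] that unfolding cycle_sets_def pairwise_def by blast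
  show "{} \<notin> cycle_sets p X"
    using least_power_of_permutation(2)[OF p] by (auto simp: cycle_sets_def)
qed

text \<open>Supports are equal or disjoint, so a cycle is the support of each of its points; the
  list \<open>support p x\<close> is distinct and has length \<open>least_power p x\<close>.\<close>

lemma card_cycle_set:
  assumes "finite X" "p permutes X" "A \<in> cycle_sets p X" "x \<in> A"
  shows "card A = least_power p x"
proof -
  have p: "permutation p" using assms permutation_permutes by blast
  have "A = set (support p x)"
    using disjoint_support[OF p] mem_support_self[OF p, of x] assms(3,4)
    unfolding cycle_sets_def pairwise_def disjnt_def by blast
  then show ?thesis using distinct_card[OF cycle_of_permutation[OF p, of x]] by simp
qed

text \<open>The points of period \<open>l\<close> are the disjoint union of the cycles of size
  \<open>l\<close>. This lets cycles be counted through the periods of points.\<close>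

lemma card_least_power_eq:
  assumes "finite X" "p permutes X"
  shows "card {x \<in> X. least_power p x = l} = l * card {A \<in> cycle_sets p X. card A = l}"
proof -
  note part = partition_on_cycle_sets[OF assms]
  have fin: "finite A" if "A \<in> cycle_sets p X" for A
    using that by (auto simp: cycle_sets_def)
  have "{x \<in> X. least_power p x = l} = \<Union>{A \<in> cycle_sets p X. card A = l}"
  proof (intro set_eqI iffI)
    fix x assume x: "x \<in> {x \<in> X. least_power p x = l}"
    then obtain A where "A \<in> cycle_sets p X" "x \<in> A" using partition_onD1[OF part] by auto
    then show "x \<in> \<Union>{A \<in> cycle_sets p X. card A = l}"
      using x card_cycle_set[OF assms] by auto
  next
    fix x assume "x \<in> \<Union>{A \<in> cycle_sets p X. card A = l}"
    then obtain A where A: "A \<in> cycle_sets p X" "x \<in> A" "card A = l" by auto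
    then have "x \<in> X" using partition_onD1[OF part] by auto
    then show "x \<in> {x \<in> X. least_power p x = l}" using card_cycle_set[OF assms A(1,2)] A(3) by simp
  qed
  also have "card \<dots> = (\<Sum>A | A \<in> cycle_sets p X \<and> card A = l. card A)"
    using partition_onD2[OF part] fin by (intro card_Union_disjoint) (auto simp: pairwise_def)
  finally show ?thesis by simp
qed

text \<open>By injectivity of \<open>p\<close>, being fixed means that \<open>count M\<close> does
  not change along \<open>p\<close>, and therefore not along a whole cycle.\<close>

lemma image_mset_fixed_iff:
  assumes "finite X" "p permutes X" "set_mset M \<subseteq> X"
  shows "image_mset p M = M \<longleftrightarrow> (\<forall>A\<in>cycle_sets p X. \<forall>x\<in>A. \<forall>y\<in>A. count M x = count M y)"
proof -
  have p: "permutation p" using assms permutation_permutes by blast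
  have cnt: "count (image_mset p M) (p x) = count M x" for x
    using permutes_inj[OF assms(2)] by (induction M) (auto simp: inj_eq)
  have "image_mset p M = M \<longleftrightarrow> (\<forall>x. count M (p x) = count M x)"
  proof
    assume "image_mset p M = M"
    then show "\<forall>x. count M (p x) = count M x" using cnt by simp
  next
    assume step: "\<forall>x. count M (p x) = count M x"
    show "image_mset p M = M"
    proof (rule multiset_eqI)
      fix y
      obtain x where "y = p x" using permutes_surj[OF assms(2)] by (rule surjE)
      then show "count (image_mset p M) y = count M y" using cnt step by simp
    qed
  qed
  also have "\<dots> \<longleftrightarrow> (\<forall>A\<in>cycle_sets p X. \<forall>x\<in>A. \<forall>y\<in>A. count M x = count M y)"
  proof
    assume step: "\<forall>x. count M (p x) = count M x"
    have "count M ((p ^^ i) x) = count M x" for i x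
      by (induction i) (simp_all add: step)
    then have orbit: "count M y = count M x" if "y \<in> set (support p x)" for x y
      using that unfolding support_set[OF p] by fastforce
    show "\<forall>A\<in>cycle_sets p X. \<forall>x\<in>A. \<forall>y\<in>A. count M x = count M y"
    proof (intro ballI)
      fix A x y assume A: "A \<in> cycle_sets p X" and xy: "x \<in> A" "y \<in> A"
      obtain z where "A = set (support p z)" using A unfolding cycle_sets_def by (rule imageE)
      then have "count M x = count M z" "count M y = count M z" using xy orbit by blast+
      then show "count M x = count M y" by (rule trans[OF _ sym])
    qed
  next
    assume const: "\<forall>A\<in>cycle_sets p X. \<forall>x\<in>A. \<forall>y\<in>A. count M x = count M y"
    show "\<forall>x. count M (p x) = count M x"
    proof
      fix x
      have "p x \<in> set (support p x)"
        unfolding support_set[OF p] by (rule range_eqI[of _ _ 1]) simp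
      \<comment> \<open>Inside \<open>X\<close>, both points lie on one cycle; outside
        \<open>X\<close>, \<open>p\<close> fixes \<open>x\<close>.\<close>
      then show "count M (p x) = count M x"
        using const mem_support_self[OF p, of x] permutes_not_in[OF assms(2), of x]
        unfolding cycle_sets_def by (cases "x \<in> X") (blast, metis)
    qed
  qed
  finally show ?thesis .
qed

text \<open>The cycles are grouped by length. \<open>T\<close> may be any finite set containing all
  periods: a value that is no period gets exponent 0.\<close>

lemma fps_fixed_multisets:
  assumes "finite X" "p permutes X" "finite T" "least_power p ` X \<subseteq> T"
  shows "Abs_fps (\<lambda>c. real (card {M. set_mset M \<subseteq> X \<and> size M = c \<and> image_mset p M = M}))
    = (\<Prod>l\<in>T. geom l ^ (card {x \<in> X. least_power p x = l} div l))"
proof -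
  note part = partition_on_cycle_sets[OF assms(1,2)]
  have fin: "finite (cycle_sets p X)" using assms(1) by (simp add: cycle_sets_def)
  have finA: "finite A" if "A \<in> cycle_sets p X" for A
    using that by (auto simp: cycle_sets_def)
  have T: "card A \<in> T" if A: "A \<in> cycle_sets p X" for A
  proof -
    obtain x where x: "x \<in> A" using partition_onD3[OF part] A by fastforce
    then show ?thesis
      using card_cycle_set[OF assms(1,2) A x] partition_onD1[OF part] A assms(4) by auto
  qed
  have "Abs_fps (\<lambda>c. real (card {M. set_mset M \<subseteq> X \<and> size M = c \<and> image_mset p M = M}))
    = Abs_fps (\<lambda>c. real (card {M. set_mset M \<subseteq> \<Union>(cycle_sets p X) \<and> size M = c \<and>
      (\<forall>A\<in>cycle_sets p X. \<forall>x\<in>A. \<forall>y\<in>A. count M x = count M y)}))"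
  proof -
    have "{M. set_mset M \<subseteq> X \<and> size M = c \<and> image_mset p M = M}
        = {M. set_mset M \<subseteq> X \<and> size M = c \<and>
          (\<forall>A\<in>cycle_sets p X. \<forall>x\<in>A. \<forall>y\<in>A. count M x = count M y)}" for c
      by (intro Collect_cong conj_cong refl image_mset_fixed_iff[OF assms(1,2)])
    then show ?thesis unfolding partition_onD1[OF part, symmetric] by simp
  qed
  also have "\<dots> = (\<Prod>A\<in>cycle_sets p X. geom (card A))"
    using partition_onD2[OF part] partition_onD3[OF part] fin finA
    by (intro fps_multisets_constant_on_parts) auto
  also have "\<dots> = (\<Prod>l\<in>T. \<Prod>A | A \<in> cycle_sets p X \<and> card A = l. geom (card A))"
    using fin assms(3) T by (intro prod.group[symmetric]) auto
  also have "\<dots> = (\<Prod>l\<in>T. geom l ^ (card {x \<in> X. least_power p x = l} div l))"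
  proof (rule prod.cong)
    fix l assume "l \<in> T"
    have "card {A \<in> cycle_sets p X. card A = l} = card {x \<in> X. least_power p x = l} div l"
    \<comment> \<open>For \<open>l = 0\<close> both sides vanish: no cycle is empty, and division by
      0 yields 0.\<close>
    proof (cases "l = 0")
      case True
      have "{A \<in> cycle_sets p X. card A = 0} = {}"
        using finA partition_onD3[OF part] by (auto simp del: card_gt_0_iff simp: card_eq_0_iff)
      then show ?thesis using True by (simp only: card.empty div_by_0)
    next
      case False
      then show ?thesis by (simp add: card_least_power_eq[OF assms(1,2)])
    qed
    then show "(\<Prod>A | A \<in> cycle_sets p X \<and> card A = l. geom (card A))
        = geom l ^ (card {x \<in> X. least_power p x = l} div l)"
      by simp
  qed simp
  finally show ?thesis .
qed

section \<open>Permutations of a given cycle type\<close>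

lemma funpow_cong_on:
  assumes "\<And>y. y \<in> Z \<Longrightarrow> f y = g y" "\<And>y. y \<in> Z \<Longrightarrow> f y \<in> Z" "x \<in> Z"
  shows "(f ^^ i) x = (g ^^ i) x"
proof -
  have "(f ^^ i) x \<in> Z \<and> (f ^^ i) x = (g ^^ i) x"
    by (induction i) (use assms in auto)
  then show ?thesis ..
qed

lemma least_power_cong:
  assumes "\<And>i. (f ^^ i) x = (g ^^ i) x"
  shows "least_power f x = least_power g x"
  by (simp add: least_power_def assms)

text \<open>\<open>h\<close> is the identity on \<open>xs\<close>, so \<open>g\<close> acts as the
  cycle on \<open>xs\<close> and as \<open>h\<close> elsewhere, and both regions are invariant. The
  last claim makes \<open>xs\<close> recoverable from \<open>g\<close> and its first entry.\<close>

lemma adjoin_cycle: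
  assumes h: "h permutes S - set xs" and xs: "distinct xs" "xs \<noteq> []" "set xs \<subseteq> S"
  defines "g \<equiv> h \<circ> cycle_of_list xs"
  shows "g permutes S"
    and "y \<notin> set xs \<Longrightarrow> g y = h y"
    and "y \<in> S - set xs \<Longrightarrow> least_power g y = least_power h y"
    and "y \<in> set xs \<Longrightarrow> least_power g y = length xs"
    and "support g (hd xs) = xs"
proof -
  show g: "g permutes S"
    unfolding g_def using permutes_subset[OF h] permutes_subset[OF cycle_permutes xs(3)]
    by (intro permutes_compose) auto
  show outside: "g y = h y" if "y \<notin> set xs" for y
    using that by (simp add: g_def id_outside_supp)
  have inside: "cycle_of_list xs y = g y" if "y \<in> set xs" for y
    using that h permutes_in_image[OF cycle_permutes[of xs], of y]
    by (simp add: g_def permutes_not_in)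
  show "least_power g y = least_power h y" if "y \<in> S - set xs"
  proof (intro least_power_cong funpow_cong_on)
    show "g z \<in> S - set xs" if "z \<in> S - set xs" for z
      using that permutes_in_image[OF h, of z] outside[of z] by auto
  qed (use that outside in auto)
  \<comment> \<open>The \<open>i\<close>-th power of the cycle rotates the list by \<open>i\<close>
    places.\<close>
  have pow: "(g ^^ i) (xs ! j) = xs ! ((i + j) mod length xs)" if j: "j < length xs" for i j
  proof -
    have "(g ^^ i) (xs ! j) = (cycle_of_list xs ^^ i) (xs ! j)"
      using inside permutes_in_image[OF cycle_permutes[of xs]] j
      by (intro funpow_cong_on[of "set xs"]) (metis nth_mem)+
    also have "\<dots> = map (cycle_of_list xs ^^ i) xs ! j" using j by simp
    also have "\<dots> = xs ! ((i + j) mod length xs)"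
      unfolding cyclic_rotation[OF xs(1)] using j by (simp add: nth_rotate)
    finally show ?thesis .
  qed
  show period: "least_power g y = length xs" if y: "y \<in> set xs" for y
  proof (rule antisym)
    obtain j where j: "j < length xs" "y = xs ! j" using y by (auto simp: in_set_conv_nth)
    have len: "(g ^^ length xs) y = y" "length xs > 0" using j xs(2) by (auto simp: pow)
    then show "least_power g y \<le> length xs" by (rule least_power_le)
    define l where "l = least_power g y"
    have l: "(g ^^ l) y = y" "l > 0"
      unfolding l_def by (rule least_powerI[OF len])+
    \<comment> \<open>As the entries are distinct, returning to the entry at \<open>j\<close> after
      \<open>l\<close> steps forces \<open>length xs\<close> to divide \<open>l\<close>.\<close>
    then have "(l + j) mod length xs = j mod length xs"
      using j xs(1) nth_eq_iff_index_eq[OF xs(1), of "(l + j) mod length xs" j] len(2)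
      by (simp add: pow)
    then have "length xs dvd l" by (metis add_diff_cancel_right' mod_eq_dvd_iff_nat le_add2)
    then show "length xs \<le> least_power g y" using l by (auto simp: l_def intro: dvd_imp_le)
  qed
  show "support g (hd xs) = xs"
    using xs(2) period[of "hd xs"] by (intro nth_equalityI) (simp_all add: hd_conv_nth pow)
qed

text \<open>The converse of adjoining a cycle: the cycle through \<open>x\<close> is listed starting
  from \<open>x\<close>, and \<open>h\<close> keeps the remaining part of \<open>g\<close>.\<close>

lemma remove_cycle:
  assumes S: "finite S" and g: "g permutes S" and x: "x \<in> S"
  defines "h \<equiv> \<lambda>y. if y \<in> S - set (support g x) then g y else y"
  shows "h permutes S - set (support g x)"
    and "g = h \<circ> cycle_of_list (support g x)"
    and "distinct (support g x)" and "support g x \<noteq> []" and "set (support g x) \<subseteq> S"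
    and "hd (support g x) = x"
proof -
  have p: "permutation g" using S g permutation_permutes by blast
  show h: "h permutes S - set (support g x)"
    unfolding h_def using semidecomposition[OF g S] .
  show "distinct (support g x)" by (rule cycle_of_permutation[OF p])
  show ne: "support g x \<noteq> []" using least_power_of_permutation(2)[OF p, of x] by simp
  show "set (support g x) \<subseteq> S" using permutes_in_funpow_image[OF g x] by auto
  show "hd (support g x) = x" using ne by (simp add: hd_map)
  show "g = h \<circ> cycle_of_list (support g x)"
  proof
    fix y
    show "g y = (h \<circ> cycle_of_list (support g x)) y"
    proof (cases "y \<in> set (support g x)")
      case True
      then show ?thesis
        using cycle_restrict[OF p True] permutes_in_image[OF cycle_permutes[of "support g x"], of y] h
        by (simp add: permutes_not_in del: set_map)
    next
      case False
      then show ?thesis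
        using g by (auto simp: id_outside_supp h_def permutes_not_in simp del: set_map)
    qed
  qed
qed

text \<open>The cycle type is expressed through periods of points: \<open>m t\<close> cycles of
  length \<open>t\<close> cover \<open>t * m t\<close> points. The value \<open>m 0\<close> is left
  unconstrained.\<close>

definition perms_of_type :: "'a set \<Rightarrow> (nat \<Rightarrow> nat) \<Rightarrow> ('a \<Rightarrow> 'a) set" where
  "perms_of_type S m = {g. g permutes S \<and> (\<forall>t. card {x \<in> S. least_power g x = t} = t * m t)}"

text \<open>The new cycle changes only the number of points of period \<open>length xs\<close>, by
  exactly that length. Positivity of \<open>m\<close> there makes the natural subtraction exact. The
  equivalence serves both directions of the bijection between marked permutations and their
  pieces.\<close>

lemma adjoin_cycle_type_iff:
  assumes S: "finite S" and h: "h permutes S - set xs"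
    and xs: "distinct xs" "xs \<noteq> []" "set xs \<subseteq> S" and m: "m (length xs) > 0"
  shows "h \<circ> cycle_of_list xs \<in> perms_of_type S m
    \<longleftrightarrow> h \<in> perms_of_type (S - set xs) (m(length xs := m (length xs) - 1))"
proof -
  let ?g = "h \<circ> cycle_of_list xs" and ?m' = "m(length xs := m (length xs) - 1)"
  note adj = adjoin_cycle[OF h xs]
  have card_eq: "card {x \<in> S. least_power ?g x = t}
      = card {x \<in> S - set xs. least_power h x = t} + (if t = length xs then length xs else 0)" for t
  proof -
    have "{x \<in> S. least_power ?g x = t}
        = {x \<in> S - set xs. least_power h x = t} \<union> (if t = length xs then set xs else {})"
      using adj(3,4) xs(3) by (cases "t = length xs") (auto, metis)
    moreover have "card \<dots> = card {x \<in> S - set xs. least_power h x = t}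
        + card (if t = length xs then set xs else {})"
      using S by (intro card_Un_disjoint) auto
    ultimately show ?thesis using xs(1) by (auto simp: distinct_card)
  qed
  have mt: "t * m t = t * ?m' t + (if t = length xs then length xs else 0)" for t
    using m by (cases "m (length xs)") auto
  show ?thesis
    unfolding perms_of_type_def mem_Collect_eq card_eq mt using h adj(1) by simp
qed

text \<open>Counting pairs of a permutation and a point on one of its cycles of length \<open>t\<close>:
  such a pair amounts to the cycle, listed from that point, and a permutation of the rest.\<close>

lemma card_perms_of_type_rec:
  assumes S: "finite S" and t: "t > 0" "m t > 0"
  shows "card (perms_of_type S m) * (t * m t)
    = (\<Sum>xs | length xs = t \<and> distinct xs \<and> set xs \<subseteq> S.
        card (perms_of_type (S - set xs) (m(t := m t - 1))))"
proof -
  let ?L = "{xs. length xs = t \<and> distinct xs \<and> set xs \<subseteq> S}" and ?m' = "m(t := m t - 1)"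
  have fin: "finite (perms_of_type R m)" if "finite R" for R :: "'a set" and m
    using finite_permutations[OF that] by (auto simp: perms_of_type_def intro: rev_finite_subset)
  have finL: "finite ?L"
    by (rule finite_subset[OF _ finite_lists_length_eq[OF S, of t]]) auto
  define A where "A = Sigma (perms_of_type S m) (\<lambda>g. {x \<in> S. least_power g x = t})"
  define B where "B = Sigma ?L (\<lambda>xs. perms_of_type (S - set xs) ?m')"
  define join where "join = (\<lambda>(xs, h :: 'a \<Rightarrow> 'a). (h \<circ> cycle_of_list xs, hd xs))"
  define cut where "cut = (\<lambda>(g, x). (support g x,
      \<lambda>y. if y \<in> S - set (support g x) then g y else y))"
  have "bij_betw join B A"
  proof (rule bij_betw_byWitness[where f' = cut])
    show "\<forall>p\<in>B. cut (join p) = p"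
    proof
      fix p assume "p \<in> B"
      then obtain xs h where p: "p = (xs, h)" "xs \<in> ?L" "h \<in> perms_of_type (S - set xs) ?m'"
        by (auto simp: B_def)
      then have h: "h permutes S - set xs" and xs: "distinct xs" "xs \<noteq> []" "set xs \<subseteq> S"
        using t by (auto simp: perms_of_type_def)
      \<comment> \<open>Cutting restores \<open>h\<close>, because \<open>h\<close> fixes every
        entry of \<open>xs\<close>.\<close>
      have "(\<lambda>y. if y \<in> S - set xs then (h \<circ> cycle_of_list xs) y else y) = h"
        using adjoin_cycle(2)[OF h xs] h by (auto simp: permutes_not_in)
      then show "cut (join p) = p"
        by (simp only: p(1) join_def cut_def prod.case adjoin_cycle(5)[OF h xs])
    qed
    show "\<forall>p\<in>A. join (cut p) = p"
    proof
      fix p assume "p \<in> A"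
      then obtain g x where p: "p = (g, x)" "g permutes S" "x \<in> S"
        by (auto simp: A_def perms_of_type_def)
      show "join (cut p) = p"
        using remove_cycle(2,6)[OF S p(2,3)] by (simp only: p(1) join_def cut_def prod.case)
    qed
    show "join ` B \<subseteq> A"
    proof
      fix q assume "q \<in> join ` B"
      then obtain xs h where q: "q = join (xs, h)" "xs \<in> ?L" "h \<in> perms_of_type (S - set xs) ?m'"
        by (auto simp: B_def)
      then have h: "h permutes S - set xs" and xs: "distinct xs" "xs \<noteq> []" "set xs \<subseteq> S"
          and len: "length xs = t"
        using t by (auto simp: perms_of_type_def)
      show "q \<in> A"
        using adjoin_cycle(4)[OF h xs, of "hd xs"] adjoin_cycle_type_iff[OF S h xs, of m] q len t xs
        by (auto simp: A_def join_def)
    qed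
    show "cut ` A \<subseteq> B"
    proof
      fix q assume "q \<in> cut ` A"
      then obtain g x where q: "q = cut (g, x)" "g \<in> perms_of_type S m" "x \<in> S" "least_power g x = t"
        by (auto simp: A_def)
      then have g: "g permutes S" by (simp add: perms_of_type_def)
      define h where "h = (\<lambda>y. if y \<in> S - set (support g x) then g y else y)"
      note rem = remove_cycle[OF S g q(3), folded h_def]
      have len: "length (support g x) = t" using q by simp
      have "h \<in> perms_of_type (S - set (support g x)) ?m'"
        using adjoin_cycle_type_iff[OF S rem(1,3,4,5), of m] q(2) t
        unfolding rem(2)[symmetric] len by simp
      then show "q \<in> B"
        using rem(3,5) len unfolding q(1) cut_def prod.case h_def[symmetric] B_def by blast
    qed
  qed
  then have "card A = card B" by (simp add: bij_betw_same_card)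
  moreover have "card A = card (perms_of_type S m) * (t * m t)"
  proof -
    have "card A = (\<Sum>g\<in>perms_of_type S m. card {x \<in> S. least_power g x = t})"
      unfolding A_def using S by (intro card_SigmaI) (auto intro: fin)
    also have "\<dots> = (\<Sum>g\<in>perms_of_type S m. t * m t)"
      by (intro sum.cong) (auto simp: perms_of_type_def)
    finally show ?thesis by simp
  qed
  moreover have "card B = (\<Sum>xs\<in>?L. card (perms_of_type (S - set xs) ?m'))"
    unfolding B_def using finL S by (intro card_SigmaI) (auto intro: fin)
  ultimately show ?thesis by simp
qed

text \<open>Strong induction on the size of \<open>S\<close>: removing a cycle of some occurring
  length \<open>t\<close> divides the weight by \<open>t * m t\<close>, which is the factor on the
  left of the recursion.\<close>

lemma card_perms_of_type:
  assumes "finite S" "(\<Sum>t=1..N. t * m t) = card S" "\<And>t. t > N \<Longrightarrow> m t = 0"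
  shows "card (perms_of_type S m) * (\<Prod>t=1..N. t ^ m t * fact (m t)) = fact (card S)"
  using assms
proof (induction "card S" arbitrary: S m rule: less_induct)
  case less
  show ?case
  proof (cases "S = {}")
    case True
    then have m0: "m t = 0" if "t > 0" for t
      using less.prems(2,3) that by (cases "t \<le> N") auto
    then have "perms_of_type S m = {id}"
      using True by (fastforce simp: perms_of_type_def permutes_empty)
    then show ?thesis using True m0 by simp
  next
    case False
    then have "card S \<noteq> 0" using less.prems(1) by simp
    then obtain t where t: "t \<in> {1..N}" "m t > 0"
      using less.prems(2) by (metis (no_types, lifting) gr0I mult_0_right sum.neutral)
    define m' where "m' = m(t := m t - 1)"
    define W where "W m = (\<Prod>t=1..N. t ^ m t * fact (m t) :: nat)" for m
    let ?L = "{xs. length xs = t \<and> distinct xs \<and> set xs \<subseteq> S}"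
    have mt: "s * m s = s * m' s + (if s = t then t else 0)" for s
      using t by (cases "m t") (auto simp: m'_def)
    have "card S = (\<Sum>s=1..N. s * m' s) + (\<Sum>s=1..N. if s = t then t else 0)"
      unfolding less.prems(2)[symmetric] mt sum.distrib ..
    then have sum': "card S = (\<Sum>s=1..N. s * m' s) + t" using t by simp
    have W: "W m = W m' * (t * m t)"
    proof -
      have rest: "(\<Prod>s\<in>{1..N} - {t}. s ^ m s * fact (m s) :: nat) = (\<Prod>s\<in>{1..N} - {t}. s ^ m' s * fact (m' s))"
        by (intro prod.cong) (auto simp: m'_def)
      have "t ^ m t * fact (m t) = (t ^ m' t * fact (m' t)) * (t * m t)"
        using t by (cases "m t") (auto simp: m'_def algebra_simps)
      then show ?thesis
        unfolding W_def prod.remove[OF finite_atLeastAtMost t(1)] rest by (simp add: ac_simps)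
    qed
    have IH: "card (perms_of_type (S - set xs) m') * W m' = fact (card S - t)" if "xs \<in> ?L" for xs
    proof -
      have c: "card (S - set xs) = card S - t"
        using that less.prems(1) by (auto simp: card_Diff_subset distinct_card)
      show ?thesis
        unfolding W_def c[symmetric]
      proof (rule less.hyps)
        show "card (S - set xs) < card S" using c sum' t by simp
        show "m' s = 0" if "s > N" for s using less.prems(3)[OF that] t by (auto simp: m'_def)
      qed (use less.prems c sum' in auto)
    qed
    \<comment> \<open>Ordering \<open>S\<close> means listing \<open>t\<close> of its points and
      then ordering the others.\<close>
    have cardL: "card ?L * fact (card S - t) = fact (card S)"
    proof -
      have "card ?L = \<Prod>{card S - t + 1..card S}"
        using card_lists_distinct_length_eq[OF less.prems(1), of t] sum' by simp
      moreover have "fact (card S - t) * \<Prod>{card S - t + 1..card S} = \<Prod>{1..card S}"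
        unfolding fact_prod of_nat_id using sum'
        by (subst prod.union_disjoint[symmetric]) (auto intro!: prod.cong)
      ultimately show ?thesis by (simp add: fact_prod mult.commute)
    qed
    have "card (perms_of_type S m) * W m = card (perms_of_type S m) * (t * m t) * W m'"
      by (simp add: W ac_simps)
    also have "\<dots> = (\<Sum>xs\<in>?L. card (perms_of_type (S - set xs) m') * W m')"
      using card_perms_of_type_rec[OF less.prems(1), of t m] t
      by (simp add: m'_def sum_distrib_right)
    also have "\<dots> = (\<Sum>xs\<in>?L. fact (card S - t))"
      by (rule sum.cong[OF refl IH])
    also have "\<dots> = fact (card S)" using cardL by simp
    finally show ?thesis by (simp add: W_def)
  qed
qed

section \<open>Equivariant polynomial maps\<close>

lemma sum_fun_apply: "(\<Sum>i\<in>A. f i) x = (\<Sum>i\<in>A. f i x)"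
  by (induction A rule: infinite_finite_induct) simp_all

lemma vector_space_fun: "vector_space (\<lambda>r f. (\<lambda>x :: 'a. r * f x :: real))"
  by unfold_locales (auto simp: fun_eq_iff algebra_simps)

lemma vector_space_fun2: "vector_space (\<lambda>r f. (\<lambda>(x :: 'a) (y :: 'b). r * f x y :: real))"
  by unfold_locales (auto simp: fun_eq_iff algebra_simps)

lemma finite_idx: "finite (idx n k)"
  using finite_lists_length_eq[of "{..<n}" k] by (simp add: idx_def conj_commute)

lemma finite_monoms_deg: "finite (monoms_deg n k c)"
  unfolding monoms_deg_def by (rule finite_multisets_size[OF finite_idx])

lemma map_in_idx_iff:
  assumes "g permutes {..<n}"
  shows "map g js \<in> idx n k \<longleftrightarrow> js \<in> idx n k"
  using permutes_in_image[OF assms] by (auto simp: idx_def)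

lemma map_in_idx:
  assumes "g permutes {..<n}" "js \<in> idx n k"
  shows "map g js \<in> idx n k"
  using assms by (simp add: map_in_idx_iff)

lemma image_mset_in_monoms_deg:
  assumes "g permutes {..<n}" "M \<in> monoms_deg n k c"
  shows "image_mset (map g) M \<in> monoms_deg n k c"
  using assms map_in_idx[OF assms(1)] by (auto simp: monoms_deg_def)

lemma map_inv_map:
  assumes "g permutes S"
  shows "map g (map (inv g) js) = js" "map (inv g) (map g js) = js"
  using permutes_inverses[OF assms] by (simp_all add: map_idI)

lemma image_mset_map_inv:
  assumes "g permutes S"
  shows "image_mset (map g) (image_mset (map (inv g)) M) = M"
    "image_mset (map (inv g)) (image_mset (map g) M) = M"
  by (simp_all only: multiset.map_comp comp_def map_inv_map[OF assms] multiset.map_ident)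

text \<open>A pair \<open>(M, js)\<close> stands for the monomial \<open>M\<close> in the output
  component \<open>js\<close>; the group acts diagonally.\<close>

definition act :: "(nat \<Rightarrow> nat) \<Rightarrow> nat list multiset \<times> nat list \<Rightarrow> nat list multiset \<times> nat list" where
  "act g y = (image_mset (map g) (fst y), map g (snd y))"

definition orbit_rel :: "nat \<Rightarrow> nat \<Rightarrow> nat \<Rightarrow> nat
    \<Rightarrow> ((nat list multiset \<times> nat list) \<times> (nat list multiset \<times> nat list)) set" where
  "orbit_rel n k d c = {(y, z). y \<in> monoms_deg n k c \<times> idx n d
      \<and> (\<exists>g. g permutes {..<n} \<and> z = act g y)}"

lemma act_closed:
  assumes "g permutes {..<n}" "y \<in> monoms_deg n k c \<times> idx n d"
  shows "act g y \<in> monoms_deg n k c \<times> idx n d"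
  using assms image_mset_in_monoms_deg map_in_idx by (auto simp: act_def)

lemma act_id: "act id y = y"
  by (simp add: act_def)

lemma act_comp: "act (g \<circ> h) y = act g (act h y)"
  by (simp add: act_def multiset.map_comp comp_def)

lemma orbit_rel_burnside:
  shows "equiv (monoms_deg n k c \<times> idx n d) (orbit_rel n k d c)"
    and "card ((monoms_deg n k c \<times> idx n d) // orbit_rel n k d c) * fact n
      = (\<Sum>g | g permutes {..<n}. card {y \<in> monoms_deg n k c \<times> idx n d. act g y = y})"
  using burnside_permutes[of "{..<n}" "monoms_deg n k c \<times> idx n d" act]
  by (simp_all add: finite_monoms_deg finite_idx act_closed act_id act_comp orbit_rel_def del: mem_Sigma_iff)

definition poly_map :: "nat \<Rightarrow> nat \<Rightarrow> nat \<Rightarrow> nat \<Rightarrow> (nat list multiset \<times> nat list \<Rightarrow> real)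
    \<Rightarrow> (nat list \<Rightarrow> real) \<Rightarrow> nat list \<Rightarrow> real" where
  "poly_map n k d c a v js = (if js \<in> idx n d
      then \<Sum>M\<in>monoms_deg n k c. a (M, js) * prod_mset (image_mset v M) else 0)"

text \<open>This is the shape needed for the dimension count: a combination of elementary maps, each
  with one monomial in one component and zero in all others.\<close>

lemma poly_map_eq_sum:
  "poly_map n k d c a = (\<Sum>y\<in>monoms_deg n k c \<times> idx n d.
      (\<lambda>v js. a y * (if js = snd y then prod_mset (image_mset v (fst y)) else 0)))"
proof (intro ext)
  fix v js
  have "(\<Sum>y\<in>monoms_deg n k c \<times> idx n d.
      (\<lambda>v js. a y * (if js = snd y then prod_mset (image_mset v (fst y)) else 0))) v js
    = (\<Sum>M\<in>monoms_deg n k c. \<Sum>is\<in>idx n d. if js = is then a (M, is) * prod_mset (image_mset v M) else 0)"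
    unfolding sum_fun_apply sum.cartesian_product by (intro sum.cong) auto
  also have "\<dots> = poly_map n k d c a v js"
    by (simp add: poly_map_def finite_idx)
  finally show "poly_map n k d c a v js = (\<Sum>y\<in>monoms_deg n k c \<times> idx n d.
      (\<lambda>v js. a y * (if js = snd y then prod_mset (image_mset v (fst y)) else 0))) v js" ..
qed

lemma poly_map_eq_0:
  assumes "\<And>v js. poly_map n k d c a v js = 0" "M \<in> monoms_deg n k c" "js \<in> idx n d"
  shows "a (M, js) = 0"
proof -
  have "(\<Sum>M\<in>monoms_deg n k c. a (M, js) * prod_mset (image_mset v M)) = 0" for v
    using assms(1)[of v js] assms(3) by (simp add: poly_map_def)
  from monomials_independent[OF finite_monoms_deg this] show ?thesis using assms(2) by blast
qed

text \<open>Acting on the argument permutes the monomials, and acting on the value permutes the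
  components. Linear independence of monomials then turns the functional identity into one for
  coefficients.\<close>

lemma poly_map_tact_iff:
  assumes g: "g permutes {..<n}"
  shows "(\<forall>v. poly_map n k d c a (tact g v) = tact g (poly_map n k d c a v))
    \<longleftrightarrow> (\<forall>y\<in>monoms_deg n k c \<times> idx n d. a (act g y) = a y)" (is "?L \<longleftrightarrow> ?R")
proof -
  have g': "inv g permutes {..<n}" using g by (rule permutes_inv)
  have tact: "poly_map n k d c a (tact g v) js = (if js \<in> idx n d
      then \<Sum>M\<in>monoms_deg n k c. a (image_mset (map g) M, js) * prod_mset (image_mset v M) else 0)"
    for v js
  proof -
    have "(\<Sum>M\<in>monoms_deg n k c. a (M, js) * prod_mset (image_mset (tact g v) M))
      = (\<Sum>M\<in>monoms_deg n k c. a (image_mset (map g) M, js) * prod_mset (image_mset v M))"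
    proof (rule sum.reindex_bij_witness[of _ "image_mset (map g)" "image_mset (map (inv g))"])
      fix M assume "M \<in> monoms_deg n k c"
      show "a (image_mset (map g) (image_mset (map (inv g)) M), js)
          * prod_mset (image_mset v (image_mset (map (inv g)) M))
        = a (M, js) * prod_mset (image_mset (tact g v) M)"
        unfolding image_mset_map_inv[OF g] by (simp add: multiset.map_comp comp_def tact_def)
    qed (auto simp only: image_mset_map_inv[OF g]
        intro: image_mset_in_monoms_deg[OF g] image_mset_in_monoms_deg[OF g'])
    then show ?thesis by (simp add: poly_map_def)
  qed
  have rhs: "tact g (poly_map n k d c a v) js = (if js \<in> idx n d
      then \<Sum>M\<in>monoms_deg n k c. a (M, map (inv g) js) * prod_mset (image_mset v M) else 0)" for v js
    by (simp add: tact_def poly_map_def map_in_idx_iff[OF g'])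
  show ?thesis
  proof
    assume L: ?L
    show ?R
    proof clarify
      fix M js assume M: "M \<in> monoms_deg n k c" and js: "js \<in> idx n d"
      have "(\<Sum>M\<in>monoms_deg n k c. (a (image_mset (map g) M, map g js) - a (M, js))
          * prod_mset (image_mset v M)) = 0" for v
      proof -
        \<comment> \<open>Evaluation at \<open>map g js\<close> cancels the inverse in
          \<open>tact\<close>, so that the coefficients at \<open>map g js\<close> and at
          \<open>js\<close> are compared.\<close>
        have "poly_map n k d c a (tact g v) (map g js) = tact g (poly_map n k d c a v) (map g js)"
          using L by simp
        then show ?thesis
          unfolding tact rhs
          by (simp only: map_in_idx[OF g js] if_True map_inv_map[OF g])
            (simp add: left_diff_distrib sum_subtractf)
      qed
      from monomials_independent[OF finite_monoms_deg this] show "a (act g (M, js)) = a (M, js)"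
        using M by (simp add: act_def)
    qed
  next
    assume R: ?R
    show ?L
    proof (intro allI ext)
      fix v js
      have "a (image_mset (map g) M, js) = a (M, map (inv g) js)"
        if "M \<in> monoms_deg n k c" "js \<in> idx n d" for M
        using R[rule_format, of "(M, map (inv g) js)"] that map_in_idx[OF g']
        by (simp add: act_def map_inv_map[OF g] del: map_map)
      then show "poly_map n k d c a (tact g v) js = tact g (poly_map n k d c a v) js"
        unfolding tact rhs by simp
    qed
  qed
qed

lemma orbit_constant_iff:
  "(\<forall>A\<in>(monoms_deg n k c \<times> idx n d) // orbit_rel n k d c. \<forall>x\<in>A. \<forall>y\<in>A. a x = a y)
    \<longleftrightarrow> (\<forall>g. g permutes {..<n} \<longrightarrow> (\<forall>y\<in>monoms_deg n k c \<times> idx n d. a (act g y) = a y))"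
  (is "?L \<longleftrightarrow> ?R")
proof
  assume L: ?L
  show ?R
  proof (intro allI impI ballI)
    fix g y assume g: "g permutes {..<n}" and y: "y \<in> monoms_deg n k c \<times> idx n d"
    have "(y, act g y) \<in> orbit_rel n k d c" using g y by (auto simp: orbit_rel_def)
    moreover have "y \<in> orbit_rel n k d c `` {y}"
      using equiv_class_self[OF orbit_rel_burnside(1) y] .
    ultimately show "a (act g y) = a y" using L quotientI[OF y, of "orbit_rel n k d c"] by blast
  qed
next
  assume R: ?R
  show ?L
  proof (intro ballI)
    fix A x y assume A: "A \<in> (monoms_deg n k c \<times> idx n d) // orbit_rel n k d c" and xy: "x \<in> A" "y \<in> A"
    obtain z where z: "z \<in> monoms_deg n k c \<times> idx n d" "A = orbit_rel n k d c `` {z}"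
      using A by (rule quotientE)
    have "a w = a z" if "w \<in> A" for w
      using that R z by (auto simp: orbit_rel_def)
    then show "a x = a y" using xy by simp
  qed
qed

lemma equiv_maps_eq_poly_map:
  "equiv_maps n k d c = {poly_map n k d c a | a.
    \<forall>A\<in>(monoms_deg n k c \<times> idx n d) // orbit_rel n k d c. \<forall>x\<in>A. \<forall>y\<in>A. a x = a y}"
proof -
  have "(\<forall>js\<in>idx n d. (\<lambda>v. P v js) \<in> hom_polys n k c) \<and> (\<forall>js. js \<notin> idx n d \<longrightarrow> (\<forall>v. P v js = 0))
      \<longleftrightarrow> (\<exists>a. P = poly_map n k d c a)" (is "?L \<longleftrightarrow> ?R") for P
  proof
    assume L: ?L
    then have "\<forall>js\<in>idx n d. \<exists>b. (\<lambda>v. P v js) = (\<lambda>v. \<Sum>M\<in>monoms_deg n k c. b M * prod_mset (image_mset v M))"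
      by (simp add: hom_polys_def)
    then obtain b where b: "\<forall>js\<in>idx n d. (\<lambda>v. P v js) = (\<lambda>v. \<Sum>M\<in>monoms_deg n k c. b js M * prod_mset (image_mset v M))"
      by metis
    have "P v js = poly_map n k d c (\<lambda>(M, js). b js M) v js" for v js
      using L b by (auto simp: poly_map_def fun_eq_iff)
    then show ?R by (intro exI[of _ "\<lambda>(M, js). b js M"]) (simp add: fun_eq_iff)
  next
    assume ?R
    then obtain a where P: "P = poly_map n k d c a" by auto
    have "(\<lambda>v. P v js) \<in> hom_polys n k c" if "js \<in> idx n d" for js
      unfolding hom_polys_def P poly_map_def using that by (auto intro!: exI[of _ "\<lambda>M. a (M, js)"])
    then show ?L by (simp add: P poly_map_def)
  qed
  then have "P \<in> equiv_maps n k d c \<longleftrightarrow> (\<exists>a. P = poly_map n k d c a) \<and>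
      (\<forall>g. g permutes {..<n} \<longrightarrow> (\<forall>v. P (tact g v) = tact g (P v)))" for P
    unfolding equiv_maps_def mem_Collect_eq conj_assoc[symmetric] by simp
  then show ?thesis
    unfolding orbit_constant_iff using poly_map_tact_iff[of _ n k d c] by (auto 0 3)
qed

lemma partition_on_orbits:
  "partition_on (monoms_deg n k c \<times> idx n d) ((monoms_deg n k c \<times> idx n d) // orbit_rel n k d c)"
  by (rule partition_on_quotient[OF orbit_rel_burnside(1)])

lemma rdim2_equiv_maps:
  "rdim2 (equiv_maps n k d c) = card ((monoms_deg n k c \<times> idx n d) // orbit_rel n k d c)"
  unfolding rdim2_def equiv_maps_eq_poly_map poly_map_eq_sum
proof (rule vector_space.dim_constant_on_parts[OF vector_space_fun2 _ partition_on_orbits])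
  show "finite (monoms_deg n k c \<times> idx n d)" by (simp add: finite_monoms_deg finite_idx)
  fix a :: "nat list multiset \<times> nat list \<Rightarrow> real"
  assume "(\<Sum>y\<in>monoms_deg n k c \<times> idx n d.
      (\<lambda>v js. a y * (if js = snd y then prod_mset (image_mset v (fst y)) else 0))) = 0"
  then have "poly_map n k d c a = 0" unfolding poly_map_eq_sum .
  then show "\<forall>y\<in>monoms_deg n k c \<times> idx n d. a y = 0"
    using poly_map_eq_0[of n k d c a] by auto
qed

text \<open>For \<open>d = 0\<close> the only index is \<open>[]\<close>, on which permutations act
  trivially, so equivariance becomes invariance.\<close>

lemma inv_polys_iff_equiv_maps:
  "f \<in> inv_polys n k c \<longleftrightarrow> (\<lambda>v js. if js = [] then f v else 0) \<in> equiv_maps n k 0 c"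
  by (auto simp: inv_polys_def equiv_maps_def idx_def tact_def fun_eq_iff)

text \<open>The two spaces live in different function types. Rather than transporting a basis, the
  orbit count is applied once more with plain monomials as vectors; both dimensions equal the number
  of the same orbits.\<close>

lemma rdim_inv_polys:
  "rdim (inv_polys n k c) = rdim2 (equiv_maps n k 0 c)"
proof -
  let ?Y = "monoms_deg n k c \<times> idx n 0"
  let ?Q = "?Y // orbit_rel n k 0 c"
  have idx0: "idx n 0 = {[]}" by (auto simp: idx_def)
  have sum0: "(\<Sum>y\<in>?Y. (\<lambda>v. a y * prod_mset (image_mset v (fst y)))) = (\<lambda>v. poly_map n k 0 c a v [])" for a
  proof
    fix v
    have "?Y = (\<lambda>M. (M, [])) ` monoms_deg n k c" by (auto simp: idx0)
    then show "(\<Sum>y\<in>?Y. (\<lambda>v. a y * prod_mset (image_mset v (fst y)))) v = poly_map n k 0 c a v []"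
      by (simp add: sum_fun_apply sum.reindex inj_on_def poly_map_def idx0)
  qed
  have poly_map0: "(\<lambda>v js. if js = [] then f v else 0) = poly_map n k 0 c a \<longleftrightarrow> f = (\<lambda>v. poly_map n k 0 c a v [])" for f a
    by (auto simp: fun_eq_iff poly_map_def idx0)
  have "inv_polys n k c = {(\<lambda>v. poly_map n k 0 c a v []) | a. \<forall>A\<in>?Q. \<forall>x\<in>A. \<forall>y\<in>A. a x = a y}"
    by (intro set_eqI) (simp only: inv_polys_iff_equiv_maps equiv_maps_eq_poly_map mem_Collect_eq poly_map0)
  also have "rdim \<dots> = card ?Q"
    unfolding rdim_def sum0[symmetric]
  proof (rule vector_space.dim_constant_on_parts[OF vector_space_fun _ partition_on_orbits])
    show "finite ?Y" by (simp add: finite_monoms_deg finite_idx)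
    fix a :: "nat list multiset \<times> nat list \<Rightarrow> real"
    assume "(\<Sum>y\<in>?Y. (\<lambda>v. a y * prod_mset (image_mset v (fst y)))) = 0"
    then have "poly_map n k 0 c a v js = 0" for v js
      unfolding sum0 by (cases "js = []") (auto simp: fun_eq_iff poly_map_def idx0)
    then show "\<forall>y\<in>?Y. a y = 0" using poly_map_eq_0[of n k 0 c a] by auto
  qed
  finally show ?thesis by (simp only: rdim2_equiv_maps)
qed

section \<open>Averaging over cycle types\<close>

definition cycle_type :: "'a set \<Rightarrow> ('a \<Rightarrow> 'a) \<Rightarrow> nat \<Rightarrow> nat" where
  "cycle_type S g t = card {A \<in> cycle_sets g S. card A = t}"

lemma least_power_bounds:
  assumes "finite S" "g permutes S" "x \<in> S"
  shows "least_power g x \<in> {1..card S}"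
proof -
  have p: "permutation g" using assms permutation_permutes by blast
  have "length (support g x) \<le> card S"
    using remove_cycle(3,5)[OF assms] by (metis assms(1) card_mono distinct_card)
  then show ?thesis using least_power_of_permutation(2)[OF p, of x] by simp
qed

lemma cycle_type_in_partitions_mult:
  assumes "g permutes {..<n}"
  shows "cycle_type {..<n} g \<in> partitions_mult n"
proof -
  note count = card_least_power_eq[OF finite_lessThan assms, folded cycle_type_def]
  note part = partition_on_cycle_sets[OF finite_lessThan assms]
  have "cycle_type {..<n} g t = 0" if t: "t < 1 \<or> t > n" for t
  proof -
    have "card A \<noteq> t" if A: "A \<in> cycle_sets g {..<n}" for A
    proof -
      have "A \<noteq> {}" using A partition_onD3[OF part] by auto
      then obtain x where x: "x \<in> A" by auto
      then have "x \<in> {..<n}" using A partition_onD1[OF part] by auto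
      then show ?thesis
        using least_power_bounds[OF finite_lessThan assms, of x] t
          card_cycle_set[OF finite_lessThan assms A x] by auto
    qed
    then have none: "{A \<in> cycle_sets g {..<n}. card A = t} = {}" by auto
    show ?thesis unfolding cycle_type_def none by simp
  qed
  moreover have "(\<Sum>t=1..n. t * cycle_type {..<n} g t) = n"
  proof -
    have "(\<Sum>t=1..n. t * cycle_type {..<n} g t) = (\<Sum>t=1..n. \<Sum>x\<in>{x \<in> {..<n}. least_power g x = t}. 1)"
      unfolding count[symmetric] by simp
    also have "\<dots> = (\<Sum>x\<in>{..<n}. 1)"
      using least_power_bounds[OF finite_lessThan assms] by (intro sum.group) auto
    finally show ?thesis by simp
  qed
  ultimately show ?thesis unfolding partitions_mult_def by blast
qed

text \<open>The point counts determine \<open>m t\<close> for positive \<open>t\<close>; at 0 both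
  multiplicities vanish because both functions lie in \<open>partitions_mult n\<close>.\<close>

lemma perms_of_type_eq:
  assumes "m \<in> partitions_mult n"
  shows "perms_of_type {..<n} m = {g. g permutes {..<n} \<and> cycle_type {..<n} g = m}"
proof -
  have "(\<forall>t. card {x \<in> {..<n}. least_power g x = t} = t * m t) \<longleftrightarrow> cycle_type {..<n} g = m"
    if g: "g permutes {..<n}" for g
  proof -
    have "m 0 = 0" "cycle_type {..<n} g 0 = 0"
      using assms cycle_type_in_partitions_mult[OF g] by (auto simp: partitions_mult_def)
    then show ?thesis
      unfolding card_least_power_eq[OF finite_lessThan g, folded cycle_type_def] fun_eq_iff
      by (metis mult_cancel1)
  qed
  then show ?thesis by (auto simp: perms_of_type_def)
qed

lemma finite_partitions_mult: "finite (partitions_mult n)"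
proof (rule finite_subset)
  show "finite {m. \<forall>t. (t \<in> {1..n} \<longrightarrow> m t \<in> {..n}) \<and> (t \<notin> {1..n} \<longrightarrow> m t = 0)}"
    by (rule finite_set_of_finite_funs) auto
  show "partitions_mult n \<subseteq> {m. \<forall>t. (t \<in> {1..n} \<longrightarrow> m t \<in> {..n}) \<and> (t \<notin> {1..n} \<longrightarrow> m t = 0)}"
  proof
    fix m assume m: "m \<in> partitions_mult n"
    have bound: "m t \<le> n" if "t \<in> {1..n}" for t
    proof -
      have "m t \<le> t * m t" using that by simp
      also have "\<dots> \<le> (\<Sum>t=1..n. t * m t)" using that by (intro member_le_sum) auto
      finally show ?thesis using m by (simp add: partitions_mult_def)
    qed
    have zero: "m t = 0" if "t \<notin> {1..n}" for t
    proof -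
      have "\<forall>t. (t < 1 \<or> t > n) \<longrightarrow> m t = 0"
        using m unfolding partitions_mult_def mem_Collect_eq by (rule conjunct1)
      then have "(t < 1 \<or> t > n) \<longrightarrow> m t = 0" by (rule spec)
      moreover have "t < 1 \<or> t > n" using that by auto
      ultimately show ?thesis by (rule mp)
    qed
    show "m \<in> {m. \<forall>t. (t \<in> {1..n} \<longrightarrow> m t \<in> {..n}) \<and> (t \<notin> {1..n} \<longrightarrow> m t = 0)}"
      using bound zero by (intro CollectI allI conjI impI) (simp_all only: atMost_iff)
  qed
qed

text \<open>The permutations are grouped by cycle type; each class has
  \<open>fact n * cyc_weight n m\<close> members.\<close>

lemma sum_over_cycle_types:
  fixes F :: "(nat \<Rightarrow> nat) \<Rightarrow> real"
  shows "(\<Sum>g | g permutes {..<n}. F (cycle_type {..<n} g))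
    = fact n * (\<Sum>m\<in>partitions_mult n. cyc_weight n m * F m)"
proof -
  have card: "real (card {g. g permutes {..<n} \<and> cycle_type {..<n} g = m}) = fact n * cyc_weight n m"
    if m: "m \<in> partitions_mult n" for m
  proof -
    have "card (perms_of_type {..<n} m) * (\<Prod>t=1..n. t ^ m t * fact (m t)) = fact n"
      using card_perms_of_type[of "{..<n}" m n] m by (simp add: partitions_mult_def)
    then have "real (card (perms_of_type {..<n} m) * (\<Prod>t=1..n. t ^ m t * fact (m t))) = fact n"
      by (simp only: of_nat_fact)
    then have "real (card (perms_of_type {..<n} m)) * (\<Prod>t=1..n. real t ^ m t * fact (m t)) = fact n"
      by simp
    moreover have "(\<Prod>t=1..n. real t ^ m t * fact (m t)) \<noteq> 0" by simp
    ultimately show ?thesis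
      unfolding perms_of_type_eq[OF m, symmetric] cyc_weight_def by (simp add: field_simps)
  qed
  have "(\<Sum>g | g permutes {..<n}. F (cycle_type {..<n} g))
      = (\<Sum>m\<in>partitions_mult n. \<Sum>g\<in>{g \<in> {g. g permutes {..<n}}. cycle_type {..<n} g = m}. F (cycle_type {..<n} g))"
    using finite_permutations[of "{..<n}"] finite_partitions_mult cycle_type_in_partitions_mult
    by (intro sum.group[symmetric]) auto
  also have "\<dots> = (\<Sum>m\<in>partitions_mult n. real (card {g. g permutes {..<n} \<and> cycle_type {..<n} g = m}) * F m)"
    by (intro sum.cong) auto
  also have "\<dots> = (\<Sum>m\<in>partitions_mult n. fact n * cyc_weight n m * F m)"
    by (intro sum.cong) (simp_all add: card)
  finally show ?thesis by (simp add: sum_distrib_left mult.assoc)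
qed

section \<open>Fixed points of a single permutation\<close>

lemma card_map_eq:
  assumes "finite A"
  shows "card {xs. set xs \<subseteq> A \<and> map f xs = ys} = (\<Prod>y\<leftarrow>ys. card {x \<in> A. f x = y})"
proof (induction ys)
  case Nil
  have "{xs. set xs \<subseteq> A \<and> map f xs = []} = {[]}" by auto
  then show ?case by simp
next
  case (Cons y ys)
  have "{xs. set xs \<subseteq> A \<and> map f xs = y # ys}
      = (\<lambda>(x, xs). x # xs) ` ({x \<in> A. f x = y} \<times> {xs. set xs \<subseteq> A \<and> map f xs = ys})"
    by (auto simp: Cons_eq_map_conv map_eq_Cons_conv image_iff)
  also have "card \<dots> = card {x \<in> A. f x = y} * card {xs. set xs \<subseteq> A \<and> map f xs = ys}"
    by (subst card_image) (auto simp: inj_on_def card_cartesian_product)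
  finally show ?case by (simp add: Cons.IH)
qed

text \<open>The count of fixed multisets is applied to the permutation that \<open>g\<close> induces
  on the \<open>k\<close>-tuples. Tuples of a given period are sorted by the list of periods of
  their entries, which is where \<open>tuples n k\<close> enters.\<close>

lemma fps_fixed_monomials:
  assumes g: "g permutes {..<n}"
  shows "Abs_fps (\<lambda>c. real (card {M \<in> monoms_deg n k c. image_mset (map g) M = M}))
    = (\<Prod>js\<in>tuples n k. geom (Lcm (set js)) ^ cyc_exp (cycle_type {..<n} g) js)"
proof -
  define m where "m = cycle_type {..<n} g"
  \<comment> \<open>Setting \<open>p\<close> to the identity off the index set makes it a
    permutation of a finite set.\<close>
  define p where "p js = (if js \<in> idx n k then map g js else js)" for js
  define T where "T = (\<lambda>js. Lcm (set js)) ` tuples n k"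
  have perm_g: "permutation g" using g permutation_permutes by blast
  have p: "p permutes idx n k"
  proof (rule bij_imp_permutes)
    have "inj_on p (idx n k)"
      using permutes_inj[OF g] by (auto simp: inj_on_def p_def inj_map_eq_map)
    moreover have "p ` idx n k \<subseteq> idx n k" using map_in_idx[OF g] by (auto simp: p_def)
    ultimately show "bij_betw p (idx n k) (idx n k)"
      by (simp add: bij_betw_def endo_inj_surj finite_idx)
  qed (simp add: p_def)
  then have perm_p: "permutation p" using finite_idx permutation_permutes by blast
  have pow: "(p ^^ i) js = map (g ^^ i) js" if "js \<in> idx n k" for i js
  proof -
    have mem: "map (g ^^ i) js \<in> idx n k" for i
      using that permutes_in_image[OF permutes_funpow[OF g]] by (auto simp: idx_def)
    show ?thesis
    proof (induction i)
      case (Suc i)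
      then show ?case using mem[of i] by (simp add: p_def)
    qed simp
  qed
  have lp: "least_power p js = Lcm (set (map (least_power g) js))" if js: "js \<in> idx n k" for js
  proof -
    \<comment> \<open>Both numbers have the same multiples: \<open>p ^^ i\<close> fixes a tuple
      exactly when \<open>g ^^ i\<close> fixes each entry.\<close>
    have "least_power p js dvd i \<longleftrightarrow> Lcm (set (map (least_power g) js)) dvd i" for i
    proof -
      have "least_power p js dvd i \<longleftrightarrow> map (g ^^ i) js = js"
        by (simp add: least_power_dvd[OF perm_p] pow[OF js])
      also have "\<dots> \<longleftrightarrow> (\<forall>j\<in>set js. least_power g j dvd i)"
        unfolding least_power_dvd[OF perm_g] by (induction js) auto
      also have "\<dots> \<longleftrightarrow> Lcm (set (map (least_power g) js)) dvd i"
        by (simp add: Lcm_dvd_iff)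
      finally show ?thesis .
    qed
    then show ?thesis by (meson dvd_antisym dvd_refl)
  qed
  have tup: "map (least_power g) js \<in> tuples n k" if "js \<in> idx n k" for js
    using that least_power_bounds[OF finite_lessThan g] by (fastforce simp: idx_def tuples_def)
  have finT: "finite (tuples n k)"
    using finite_lists_length_eq[of "{1..n}" k] by (simp add: tuples_def conj_commute)
  have count: "card {x \<in> idx n k. least_power p x = l} div l = (\<Sum>js | js \<in> tuples n k \<and> Lcm (set js) = l. cyc_exp m js)"
    if l: "l \<in> T" for l
  proof -
    obtain js where "js \<in> tuples n k" "l = Lcm (set js)" using l by (auto simp: T_def)
    moreover from this have "0 \<notin> set js" by (auto simp: tuples_def)
    ultimately have "l \<noteq> 0" by (simp add: Lcm_0_iff)
    have fibre: "card {x \<in> idx n k. map (least_power g) x = js} = (\<Prod>j\<leftarrow>js. m j * j)"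
      if "js \<in> tuples n k" for js
    proof -
      have "{x \<in> idx n k. map (least_power g) x = js} = {x. set x \<subseteq> {..<n} \<and> map (least_power g) x = js}"
        using that by (auto simp: idx_def tuples_def)
      then show ?thesis
        using card_least_power_eq[OF finite_lessThan g, folded cycle_type_def]
        by (simp add: card_map_eq m_def mult.commute)
    qed
    have "card {x \<in> idx n k. least_power p x = l}
        = (\<Sum>x | x \<in> idx n k \<and> least_power p x = l. 1)" by simp
    also have "\<dots> = (\<Sum>js | js \<in> tuples n k \<and> Lcm (set js) = l.
        \<Sum>x | x \<in> {x \<in> idx n k. least_power p x = l} \<and> map (least_power g) x = js. 1)"
      using finite_idx finT tup lp by (intro sum.group[symmetric]) auto
    also have "\<dots> = (\<Sum>js | js \<in> tuples n k \<and> Lcm (set js) = l. \<Prod>j\<leftarrow>js. m j * j)"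
    proof (rule sum.cong)
      fix js assume js: "js \<in> {js \<in> tuples n k. Lcm (set js) = l}"
      have "{x. x \<in> {x \<in> idx n k. least_power p x = l} \<and> map (least_power g) x = js}
          = {x \<in> idx n k. map (least_power g) x = js}"
        using js lp by auto
      then show "(\<Sum>x | x \<in> {x \<in> idx n k. least_power p x = l} \<and> map (least_power g) x = js. 1)
          = (\<Prod>j\<leftarrow>js. m j * j)"
        using fibre js by simp
    qed simp
    also have "\<dots> = (\<Sum>js | js \<in> tuples n k \<and> Lcm (set js) = l. l * cyc_exp m js)"
    proof (rule sum.cong)
      fix js assume js: "js \<in> {js \<in> tuples n k. Lcm (set js) = l}"
      \<comment> \<open>Every entry divides the product, hence so does their lcm; thus the division
        in \<open>cyc_exp\<close> is exact.\<close>
      have "j dvd (\<Prod>j\<leftarrow>js. m j * j)" if "j \<in> set js" for j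
        using that by (induction js) auto
      then have "l dvd (\<Prod>j\<leftarrow>js. m j * j)" using js by (auto intro: Lcm_least)
      then show "(\<Prod>j\<leftarrow>js. m j * j) = l * cyc_exp m js" using js by (simp add: cyc_exp_def)
    qed simp
    finally show ?thesis using \<open>l \<noteq> 0\<close> by (simp add: sum_distrib_left[symmetric])
  qed
  have "{M \<in> monoms_deg n k c. image_mset (map g) M = M}
      = {M. set_mset M \<subseteq> idx n k \<and> size M = c \<and> image_mset p M = M}" for c
  proof -
    have "image_mset p M = image_mset (map g) M" if "set_mset M \<subseteq> idx n k" for M
      using that by (intro image_mset_cong) (auto simp: p_def)
    then show ?thesis by (auto simp: monoms_deg_def)
  qed
  then have "Abs_fps (\<lambda>c. real (card {M \<in> monoms_deg n k c. image_mset (map g) M = M}))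
      = Abs_fps (\<lambda>c. real (card {M. set_mset M \<subseteq> idx n k \<and> size M = c \<and> image_mset p M = M}))"
    by simp
  also have "\<dots> = (\<Prod>l\<in>T. geom l ^ (card {x \<in> idx n k. least_power p x = l} div l))"
  proof (rule fps_fixed_multisets[OF finite_idx p])
    show "finite T" using finT by (simp add: T_def)
    show "least_power p ` idx n k \<subseteq> T"
    proof
      fix l assume "l \<in> least_power p ` idx n k"
      then obtain js where js: "js \<in> idx n k" "l = least_power p js" by auto
      show "l \<in> T" unfolding T_def js(2) lp[OF js(1)] by (rule imageI[OF tup[OF js(1)]])
    qed
  qed
  also have "\<dots> = (\<Prod>l\<in>T. \<Prod>js | js \<in> tuples n k \<and> Lcm (set js) = l. geom (Lcm (set js)) ^ cyc_exp m js)"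
    by (intro prod.cong refl) (simp add: count power_sum)
  also have "\<dots> = (\<Prod>js\<in>tuples n k. geom (Lcm (set js)) ^ cyc_exp m js)"
    using finT by (intro prod.group) (auto simp: T_def)
  finally show ?thesis by (simp add: m_def)
qed

text \<open>A tuple is fixed exactly when all its entries are fixed points of \<open>g\<close>, and
  the fixed points are the cycles of length 1.\<close>

lemma card_fixed_indices:
  assumes g: "g permutes {..<n}"
  shows "card {js \<in> idx n d. map g js = js} = cycle_type {..<n} g 1 ^ d"
proof -
  have perm_g: "permutation g" using g permutation_permutes by blast
  have "least_power g x = 1 \<longleftrightarrow> g x = x" for x
    using least_power_dvd[OF perm_g, of x 1] by simp
  then have fixed: "card {x \<in> {..<n}. g x = x} = cycle_type {..<n} g 1"
    using card_least_power_eq[OF finite_lessThan g, of 1, folded cycle_type_def] by simp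
  have "{js \<in> idx n d. map g js = js} = {js. set js \<subseteq> {x \<in> {..<n}. g x = x} \<and> length js = d}"
    by (auto simp: idx_def map_idI list_eq_iff_nth_eq in_set_conv_nth subset_iff)
  then show ?thesis using card_lists_length_eq[of "{x \<in> {..<n}. g x = x}" d] fixed by simp
qed

text \<open>Coefficients are compared after multiplication by \<open>fact n\<close>, which is the
  form of the orbit count. The statement includes \<open>d = 0\<close>, the instance used for
  invariant polynomials.\<close>

lemma fps_equiv_maps: "Abs_fps (\<lambda>c. real (rdim2 (equiv_maps n k d c))) = ZW n k d geom"
proof (rule fps_ext)
  fix c
  define F where "F m = (\<Prod>js\<in>tuples n k. geom (Lcm (set js)) ^ cyc_exp m js)" for m
  have fixed: "real (card {y \<in> monoms_deg n k c \<times> idx n d. act g y = y})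
      = fps_nth (F (cycle_type {..<n} g)) c * real (cycle_type {..<n} g 1) ^ d"
    if g: "g permutes {..<n}" for g
  proof -
    \<comment> \<open>The action is diagonal, so the fixed points form a product and their count
      factorises.\<close>
    have "{y \<in> monoms_deg n k c \<times> idx n d. act g y = y}
        = {M \<in> monoms_deg n k c. image_mset (map g) M = M} \<times> {js \<in> idx n d. map g js = js}"
      by (auto simp: act_def)
    moreover have "real (card {M \<in> monoms_deg n k c. image_mset (map g) M = M})
        = fps_nth (F (cycle_type {..<n} g)) c"
      using fps_fixed_monomials[OF g, of k, THEN arg_cong, of "\<lambda>f. fps_nth f c"] by (simp add: F_def)
    ultimately show ?thesis
      by (simp add: card_cartesian_product card_fixed_indices[OF g])
  qed
  have "real (rdim2 (equiv_maps n k d c)) * fact n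
      = real (card ((monoms_deg n k c \<times> idx n d) // orbit_rel n k d c) * fact n)"
    by (simp add: rdim2_equiv_maps)
  also have "\<dots> = (\<Sum>g | g permutes {..<n}. real (card {y \<in> monoms_deg n k c \<times> idx n d. act g y = y}))"
    unfolding orbit_rel_burnside(2) by simp
  also have "\<dots> = (\<Sum>g | g permutes {..<n}.
      fps_nth (F (cycle_type {..<n} g)) c * real (cycle_type {..<n} g 1) ^ d)"
    by (intro sum.cong) (auto simp: fixed)
  also have "\<dots> = fact n * (\<Sum>m\<in>partitions_mult n. cyc_weight n m * (fps_nth (F m) c * real (m 1) ^ d))"
    by (rule sum_over_cycle_types)
  also have "(\<Sum>m\<in>partitions_mult n. cyc_weight n m * (fps_nth (F m) c * real (m 1) ^ d))
      = fps_nth (ZW n k d geom) c"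
    by (simp add: ZW_def fps_sum_nth F_def[symmetric] mult.assoc mult.commute[of "fps_nth _ _"])
  finally show "fps_nth (Abs_fps (\<lambda>c. real (rdim2 (equiv_maps n k d c)))) c = fps_nth (ZW n k d geom) c"
    by simp
qed

theorem mainTheorem9:
  fixes n k d :: nat
  assumes "n \<ge> 1" and "k \<ge> 1" and "d \<ge> 1"
  shows "Abs_fps (\<lambda>c. real (rdim (inv_polys n k c))) = Zk n k geom
    \<and> Abs_fps (\<lambda>c. real (rdim2 (equiv_maps n k d c))) = ZW n k d geom"
proof
  \<comment> \<open>The extra factor is \<open>m 1 ^ 0 = 1\<close>, also when
    \<open>m 1 = 0\<close>.\<close>
  have "Zk n k geom = ZW n k 0 geom" by (simp add: Zk_def ZW_def)
  then show "Abs_fps (\<lambda>c. real (rdim (inv_polys n k c))) = Zk n k geom"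
    by (simp add: rdim_inv_polys fps_equiv_maps)
  show "Abs_fps (\<lambda>c. real (rdim2 (equiv_maps n k d c))) = ZW n k d geom"
    by (rule fps_equiv_maps)
qed

end
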